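(* Let $\tilde{\mathcal{O}}$ be a $(1+\epsilon)$-approximate Euclidean nearest neighbor oracle and let the dataset $\mathcal{D}\subset\mathbb{H}_r$ be split into partitions with multiplicative width $w>1$. Then for any query $q$, Spherical-Shell-HyperbolicNN returns a point $n_H$ with $d_H(q,n_H)\le\sqrt{w}(1+\epsilon)\,d_H(q,n^* )$, where $n^*$ is the exact hyperbolic nearest neighbor of $q$ in $\mathcal{D}$.
   Context: $\mathbb{H}_r$ is the Poincaré ball (open unit ball of $\mathbb{R}^r$) with distance $d_H(x,y)=\operatorname{arccosh}\left(1+\frac{2\|x-y\|^2}{(1-\|x\|^2)(1-\|y\|^2)}\right)$; $\mathcal{B}_H(q,d)$ is the hyperbolic ball of center $q$ and radius $d$. A $(1+\epsilon)$-approximate Euclidean nearest neighbor oracle $\tilde{\mathcal{O}}$ returns, for a point $z$ and a set $P$, some $p\in P$ with $\|p-z\|\le(1+\epsilon)\|z-n\|$, $n$ the Euclidean nearest neighbor of $z$ in $P$. Partitioning with width $w$: the $i$-th partition $B[i]$ consists of those $x\in\mathcal{D}$ with $i=\lceil -\log(1-\|x\|^2)/\log w\rceil$, so that $w^{i-1}\le\frac{1}{1-\|x\|^2}\le w^i$. Spherical-Shell-HyperbolicNN: let $i_q=\lceil -\log(1-\|q\|^2)/\log w\rceil$; set $n_H\leftarrow\tilde{\mathcal{O}}(q,B[i_q])$. Then repeat: let $a$ be the smallest not-yet-probed index above $i_q$ and $b$ the largest not-yet-probed index below $i_q$ (bands are probed contiguously outward from $i_q$); if neither the region $\{x: w^{a-1}\le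 1/(1-\|x\|^2)\le w^{a}\}$ nor the region for $b$ intersects $\mathcal{B}_H(q,d_H(q,n_H))$, stop; otherwise choose one of $a,b$ (whose region intersects the ball) by a fixed selection rule, compute $n_F\leftarrow\tilde{\mathcal{O}}(q,B[\text{chosen}])$, and if $d_H(q,n_F)<d_H(q,n_H)$ set $n_H\leftarrow n_F$. Return $n_H$. *)

theory Defs
  imports "HOL-Analysis.Analysis" "HOL-Library.While_Combinator"
begin

text \<open>The Poincare ball model: the points are those of \<open>ball 0 1\<close>.\<close>

definition hdist :: "'a::euclidean_space \<Rightarrow> 'a \<Rightarrow> real" where
  "hdist x y = arcosh (1 + 2 * (norm (x - y))\<^sup>2 / ((1 - (norm x)\<^sup>2) * (1 - (norm y)\<^sup>2)))"

definition hball :: "'a::euclidean_space \<Rightarrow> real \<Rightarrow> 'a set" where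
  "hball q d = {x \<in> ball 0 1. hdist q x \<le> d}"

definition approx_nn_oracle :: "real \<Rightarrow> ('a::euclidean_space \<Rightarrow> 'a set \<Rightarrow> 'a) \<Rightarrow> bool" where
  "approx_nn_oracle \<epsilon> orc \<longleftrightarrow>
     (\<forall>z P. finite P \<and> P \<noteq> {} \<longrightarrow>
        orc z P \<in> P \<and>
        (\<forall>n. is_arg_min (\<lambda>p. norm (z - p)) (\<lambda>p. p \<in> P) n \<longrightarrow>
              norm (orc z P - z) \<le> (1 + \<epsilon>) * norm (z - n)))"

definition band_index :: "real \<Rightarrow> 'a::euclidean_space \<Rightarrow> int" where
  "band_index w x = \<lceil>- ln (1 - (norm x)\<^sup>2) / ln w\<rceil>"

definition band :: "real \<Rightarrow> 'a::euclidean_space set \<Rightarrow> int \<Rightarrow> 'a set" where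
  "band w D i = {x \<in> D. band_index w x = i}"

definition region :: "real \<Rightarrow> int \<Rightarrow> 'a::euclidean_space set" where
  "region w i = {x \<in> ball 0 1. w powi (i - 1) \<le> 1 / (1 - (norm x)\<^sup>2) \<and>
                               1 / (1 - (norm x)\<^sup>2) \<le> w powi i}"

text \<open>
  The current candidate is an option value: it is \<open>None\<close> as long as all bands probed so far,
  starting with that of the query, contain no data point. An empty band yields no point.
\<close>

definition probe :: "('a::euclidean_space \<Rightarrow> 'a set \<Rightarrow> 'a) \<Rightarrow> 'a \<Rightarrow> 'a set \<Rightarrow> 'a option" where
  "probe orc q P = (if P = {} then None else Some (orc q P))"

fun update :: "'a::euclidean_space \<Rightarrow> 'a option \<Rightarrow> 'a option \<Rightarrow> 'a option" where
  "update q nH None = nH"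
| "update q None (Some nF) = Some nF"
| "update q (Some nH) (Some nF) = (if hdist q nF < hdist q nH then Some nF else Some nH)"

text \<open>
  A loop state \<open>(a, b, nH)\<close> consists of the next index above, the next index below, and the
  candidate. With no candidate there is no finite radius, and every region would count as
  intersecting the ball; a direction is then eligible as long as some data point is left in it.
  (Otherwise a selection rule could walk upwards through empty bands forever.)
\<close>

type_synonym 'a nn_state = "int \<times> int \<times> 'a option"

fun above_eligible :: "real \<Rightarrow> 'a::euclidean_space set \<Rightarrow> 'a \<Rightarrow> 'a nn_state \<Rightarrow> bool" where
  "above_eligible w D q (a, b, None) \<longleftrightarrow> (\<exists>x\<in>D. a \<le> band_index w x)"
| "above_eligible w D q (a, b, Some nH) \<longleftrightarrow> region w a \<inter> hball q (hdist q nH) \<noteq> {}"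

fun below_eligible :: "real \<Rightarrow> 'a::euclidean_space set \<Rightarrow> 'a \<Rightarrow> 'a nn_state \<Rightarrow> bool" where
  "below_eligible w D q (a, b, None) \<longleftrightarrow> (\<exists>x\<in>D. band_index w x \<le> b)"
| "below_eligible w D q (a, b, Some nH) \<longleftrightarrow> region w b \<inter> hball q (hdist q nH) \<noteq> {}"

text \<open>The selection rule \<open>sel\<close> matters only when both directions are eligible.\<close>

definition choose_above ::
  "('a::euclidean_space nn_state \<Rightarrow> bool) \<Rightarrow> real \<Rightarrow> 'a set \<Rightarrow> 'a \<Rightarrow> 'a nn_state \<Rightarrow> bool" where
  "choose_above sel w D q s \<longleftrightarrow>
     above_eligible w D q s \<and> (below_eligible w D q s \<longrightarrow> sel s)"

definition nn_step ::
  "('a::euclidean_space \<Rightarrow> 'a set \<Rightarrow> 'a) \<Rightarrow> ('a nn_state \<Rightarrow> bool) \<Rightarrow> real \<Rightarrow> 'a set \<Rightarrow> 'a \<Rightarrow>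
     'a nn_state \<Rightarrow> 'a nn_state" where
  "nn_step orc sel w D q s =
     (case s of (a, b, nH) \<Rightarrow>
        if choose_above sel w D q s
        then (a + 1, b, update q nH (probe orc q (band w D a)))
        else (a, b - 1, update q nH (probe orc q (band w D b))))"

text \<open>The result is \<open>None\<close> if the loop does not terminate or ends without a candidate.\<close>

definition spherical_shell_nn ::
  "('a::euclidean_space \<Rightarrow> 'a set \<Rightarrow> 'a) \<Rightarrow> ('a nn_state \<Rightarrow> bool) \<Rightarrow> real \<Rightarrow> 'a set \<Rightarrow> 'a \<Rightarrow>
     'a option" where
  "spherical_shell_nn orc sel w D q =
     (case while_option (\<lambda>s. above_eligible w D q s \<or> below_eligible w D q s)
             (nn_step orc sel w D q)
             (band_index w q + 1, band_index w q - 1,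
              probe orc q (band w D (band_index w q)))
      of None \<Rightarrow> None
       | Some (a, b, nH) \<Rightarrow> nH)"

end

theory Submission
  imports Defs
begin

text \<open>
  Inside one band the conformal factors \<open>1 / (1 - \<parallel>x\<parallel>\<^sup>2)\<close> differ by at most the factor \<open>w\<close>, so a
  Euclidean \<open>(1 + \<epsilon>)\<close>-approximation \<open>p\<close> of \<open>x\<close> satisfies
  \<open>cosh d(q,p) - 1 \<le> c\<^sup>2 (cosh d(q,x) - 1)\<close> with \<open>c = sqrt w (1 + \<epsilon>)\<close>. As
  \<open>cosh t - 1 = 2 sinh\<^sup>2 (t/2)\<close> and \<open>c sinh t \<le> sinh (c t)\<close>, this gives \<open>d(q,p) \<le> c d(q,x)\<close>.
  Hyperbolic balls are Euclidean convex, so the segment from \<open>q\<close> to a data point in an unprobed band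
  crosses the next region in that direction without leaving the ball. Hence, when the loop stops,
  every data point in an unprobed band is farther away than the candidate. The loop stops because
  a hyperbolic ball meets only finitely many regions.
\<close>

section \<open>Half-distance formula for the hyperbolic metric\<close>

lemma norm_sq_less_1: "x \<in> ball 0 1 \<Longrightarrow> (norm x)\<^sup>2 < 1"
  for x :: "'a::real_normed_vector"
  by (simp add: abs_square_less_1)

lemma hdist_arg_ge_1:
  fixes x y :: "'a::euclidean_space"
  assumes "x \<in> ball 0 1" "y \<in> ball 0 1"
  shows "1 + 2 * (norm (x - y))\<^sup>2 / ((1 - (norm x)\<^sup>2) * (1 - (norm y)\<^sup>2)) \<ge> 1"
  using norm_sq_less_1[OF assms(1)] norm_sq_less_1[OF assms(2)] by simp

lemma hdist_nonneg:
  assumes "x \<in> ball 0 1" "y \<in> ball 0 1"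
  shows "hdist x y \<ge> 0"
  unfolding hdist_def using hdist_arg_ge_1[OF assms] by (rule arcosh_nonneg_real)

lemma cosh_hdist:
  assumes "x \<in> ball 0 1" "y \<in> ball 0 1"
  shows "cosh (hdist x y) = 1 + 2 * (norm (x - y))\<^sup>2 / ((1 - (norm x)\<^sup>2) * (1 - (norm y)\<^sup>2))"
  unfolding hdist_def using hdist_arg_ge_1[OF assms] by (rule cosh_arcosh_real)

text \<open>The half-angle formula absorbs the summand 1 of \<open>cosh\<close>; what remains is a
  pure quotient, to which multiplicative errors apply directly.\<close>

lemma sinh_half_hdist:
  assumes "x \<in> ball 0 1" "y \<in> ball 0 1"
  shows "(sinh (hdist x y / 2))\<^sup>2 = (norm (x - y))\<^sup>2 / ((1 - (norm x)\<^sup>2) * (1 - (norm y)\<^sup>2))"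
proof -
  have "cosh (2 * (hdist x y / 2)) = 2 * (sinh (hdist x y / 2))\<^sup>2 + 1"
    by (simp only: cosh_double cosh_square_eq)
  then show ?thesis
    using cosh_hdist[OF assms] by simp
qed

text \<open>\<open>sinh\<close> is increasing and both half-distances are nonnegative, so squaring
  loses nothing. For fixed \<open>q\<close> and \<open>r\<close> the result is a quadratic
  inequality in \<open>x\<close>.\<close>

lemma hdist_le_iff:
  assumes "q \<in> ball 0 1" "x \<in> ball 0 1" "r \<ge> 0"
  shows "hdist q x \<le> r \<longleftrightarrow>
    (norm (q - x))\<^sup>2 \<le> (sinh (r / 2))\<^sup>2 * (1 - (norm q)\<^sup>2) * (1 - (norm x)\<^sup>2)"
proof -
  have "hdist q x \<le> r \<longleftrightarrow> sinh (hdist q x / 2) \<le> sinh (r / 2)"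
    by simp
  also have "\<dots> \<longleftrightarrow> (sinh (hdist q x / 2))\<^sup>2 \<le> (sinh (r / 2))\<^sup>2"
    using assms hdist_nonneg[OF assms(1,2)] by (simp add: power2_le_iff_abs_le)
  also have "\<dots> \<longleftrightarrow> (norm (q - x))\<^sup>2 \<le> (sinh (r / 2))\<^sup>2 * (1 - (norm q)\<^sup>2) * (1 - (norm x)\<^sup>2)"
    using norm_sq_less_1[OF assms(1)] norm_sq_less_1[OF assms(2)]
    by (simp add: sinh_half_hdist[OF assms(1,2)] pos_divide_le_eq mult.assoc)
  finally show ?thesis .
qed

lemma mult_sinh_le_sinh_mult:
  fixes c x :: real
  assumes "c \<ge> 1" "x \<ge> 0"
  shows "c * sinh x \<le> sinh (c * x)"
proof -
  let ?f = "\<lambda>t. sinh (c * t) - c * sinh t"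
  have "?f 0 \<le> ?f x"
  proof (rule DERIV_nonneg_imp_nondecreasing[OF assms(2)])
    fix t :: real assume t: "0 \<le> t" "t \<le> x"
    have "(?f has_real_derivative c * (cosh (c * t) - cosh t)) (at t)"
      by (auto intro!: derivative_eq_intros simp: algebra_simps)
    moreover have "t \<le> c * t"
      using mult_right_mono[OF assms(1) t(1)] by simp
    then have "cosh t \<le> cosh (c * t)"
      using t assms by (subst cosh_real_nonneg_le_iff) auto
    ultimately show "\<exists>y. (?f has_real_derivative y) (at t) \<and> 0 \<le> y"
      using assms(1) by (intro exI conjI) auto
  qed
  then show ?thesis by simp
qed

section \<open>Shape of hyperbolic balls\<close>

lemma hball_convex:
  fixes q :: "'a::euclidean_space"
  assumes "q \<in> ball 0 1" "r \<ge> 0"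
  shows "convex (hball q r)"
proof (rule convexI)
  fix x y :: 'a and u v :: real
  assume x: "x \<in> hball q r" and y: "y \<in> hball q r" and uv: "0 \<le> u" "0 \<le> v" "u + v = 1"
  \<comment> \<open>Within the unit ball, membership of \<open>z\<close> reads
    \<open>(norm (q - z))\<^sup>2 + k * (norm z)\<^sup>2 \<le> k\<close>. As
    \<open>k \<ge> 0\<close>, this is a sublevel set of a convex function.\<close>
  define k where "k = (sinh (r / 2))\<^sup>2 * (1 - (norm q)\<^sup>2)"
  have k: "k \<ge> 0"
    unfolding k_def using norm_sq_less_1[OF assms(1)] by simp
  let ?z = "u *\<^sub>R x + v *\<^sub>R y"
  have z: "?z \<in> ball 0 1"
    using convex_ball[of 0 1] x y uv unfolding hball_def convex_def by blast
  have sq: "(norm (u *\<^sub>R a + v *\<^sub>R b))\<^sup>2 \<le> u * (norm a)\<^sup>2 + v * (norm b)\<^sup>2" for a b :: 'a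
  proof -
    have "(norm (u *\<^sub>R a + v *\<^sub>R b))\<^sup>2 \<le> (u * norm a + v * norm b)\<^sup>2"
      using uv by (intro power_mono order.trans[OF norm_triangle_ineq]) auto
    also have "\<dots> \<le> u * (norm a)\<^sup>2 + v * (norm b)\<^sup>2"
      using convex_power2[unfolded convex_on_def] uv by auto
    finally show ?thesis .
  qed
  have "q - ?z = u *\<^sub>R (q - x) + v *\<^sub>R (q - y)"
    using uv(3) by (simp add: algebra_simps flip: scaleR_add_left)
  then have "(norm (q - ?z))\<^sup>2 \<le> u * (norm (q - x))\<^sup>2 + v * (norm (q - y))\<^sup>2"
    using sq[of "q - x" "q - y"] by simp
  also have "\<dots> \<le> u * (k * (1 - (norm x)\<^sup>2)) + v * (k * (1 - (norm y)\<^sup>2))"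
    using x y uv hdist_le_iff[OF assms(1) _ assms(2)] unfolding hball_def k_def
    by (intro add_mono mult_left_mono) auto
  also have "\<dots> = k * ((u + v) - (u * (norm x)\<^sup>2 + v * (norm y)\<^sup>2))"
    by (simp add: algebra_simps)
  also have "\<dots> \<le> k * (1 - (norm ?z)\<^sup>2)"
    using sq[of x y] uv(3) k by (intro mult_left_mono) auto
  finally show "?z \<in> hball q r"
    using z hdist_le_iff[OF assms(1) z assms(2)] unfolding hball_def k_def by auto
qed

text \<open>A point close to the unit sphere stays away from \<open>q\<close>, yet
  \<open>hdist_le_iff\<close> bounds its squared Euclidean distance from \<open>q\<close> by a
  multiple of \<open>1 - (norm x)\<^sup>2\<close>, so this quantity cannot be small.\<close>

lemma hball_conformal_factor_bounded:
  fixes q :: "'a::euclidean_space"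
  assumes "q \<in> ball 0 1" "r \<ge> 0"
  shows "\<exists>M. \<forall>x \<in> hball q r. 1 / (1 - (norm x)\<^sup>2) \<le> M"
proof -
  define k where "k = (sinh (r / 2))\<^sup>2 * (1 - (norm q)\<^sup>2)"
  define m where "m = 1 - norm q"
  have m: "m > 0"
    using assms(1) by (simp add: m_def)
  have "1 / (1 - (norm x)\<^sup>2) \<le> max (2 / m) (4 * k / m\<^sup>2)" if "x \<in> hball q r" for x
  proof -
    have x: "x \<in> ball 0 1" and kx: "(norm (q - x))\<^sup>2 \<le> k * (1 - (norm x)\<^sup>2)"
      using that hdist_le_iff[OF assms(1) _ assms(2)] unfolding hball_def k_def by auto
    define s where "s = 1 - (norm x)\<^sup>2"
    have s: "s > 0"
      using norm_sq_less_1[OF x] by (simp add: s_def)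
    \<comment> \<open>The threshold is half the Euclidean distance \<open>m\<close> from
      \<open>q\<close> to the unit sphere: below it, \<open>1 - norm x \<le> s\<close> keeps
      \<open>x\<close> at least \<open>m / 2\<close> away from \<open>q\<close>.\<close>
    show ?thesis
    proof (cases "s < m / 2")
      case True
      have "norm x * norm x \<le> norm x * 1"
        using x by (intro mult_left_mono) auto
      then have "1 - norm x \<le> s"
        by (simp add: s_def power2_eq_square)
      moreover have "norm x \<le> norm q + norm (q - x)"
        using norm_triangle_sub[of x q] by (simp add: norm_minus_commute)
      ultimately have "m / 2 \<le> norm (q - x)"
        using True unfolding m_def by simp
      then have "(m / 2)\<^sup>2 \<le> (norm (q - x))\<^sup>2"
        using m by (intro power_mono) auto
      then have "(m / 2)\<^sup>2 \<le> k * s"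
        using kx by (simp add: s_def)
      then have "1 / s \<le> 4 * k / m\<^sup>2"
        using s m by (simp add: field_simps power2_eq_square)
      then show ?thesis
        by (simp add: s_def)
    next
      case False
      then have "1 / s \<le> 2 / m"
        using s m by (simp add: field_simps)
      then show ?thesis
        by (simp add: s_def)
    qed
  qed
  then show ?thesis by blast
qed

section \<open>Bands, regions and segments from the query\<close>

lemma mem_region_band_index:
  fixes x :: "'a::euclidean_space"
  assumes "w > 1" "x \<in> ball 0 1"
  shows "x \<in> region w (band_index w x)"
proof -
  define g where "g = 1 / (1 - (norm x)\<^sup>2)"
  have pos: "1 - (norm x)\<^sup>2 > 0"
    using norm_sq_less_1[OF assms(2)] by simp
  then have g: "g > 0"
    by (simp add: g_def)
  have i: "band_index w x = \<lceil>log w g\<rceil>"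
    using pos by (simp add: band_index_def log_def g_def ln_div)
  have powi: "w powi k = w powr (of_int k)" for k
    using assms(1) by (simp add: powr_real_of_int')
  have log: "w powr (log w g) = g"
    using assms(1) g by simp
  \<comment> \<open>The two defining inequalities of the ceiling, exponentiated, are the region
    bounds.\<close>
  have "w powr (of_int (\<lceil>log w g\<rceil> - 1)) \<le> w powr (log w g)"
    "w powr (log w g) \<le> w powr (of_int \<lceil>log w g\<rceil>)"
    using assms(1) by (intro powr_mono; linarith)+
  then show ?thesis
    using assms(2) unfolding region_def mem_Collect_eq i powi log g_def[symmetric] by blast
qed

text \<open>
  The boundary spheres of a region belong to it, so a conformal factor that crosses \<open>w powi j\<close>
  along the segment gives a point in both adjacent regions.
\<close>

lemma segment_meets_sphere:
  fixes q x :: "'a::euclidean_space"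
  assumes "w > 1" "q \<in> ball 0 1" "x \<in> ball 0 1"
    and "w powi j \<in> closed_segment (1 / (1 - (norm q)\<^sup>2)) (1 / (1 - (norm x)\<^sup>2))"
  shows "\<exists>z \<in> hball q (hdist q x). 1 / (1 - (norm z)\<^sup>2) = w powi j"
proof -
  let ?g = "\<lambda>z::'a. 1 / (1 - (norm z)\<^sup>2)"
  have d: "hdist q x \<ge> 0"
    using assms by (intro hdist_nonneg)
  have "q \<in> hball q (hdist q x)" "x \<in> hball q (hdist q x)"
    using assms d by (auto simp: hball_def hdist_def)
  then have sub: "closed_segment q x \<subseteq> hball q (hdist q x)"
    using hball_convex[OF assms(2) d] by (intro closed_segment_subset)
  have "continuous_on (closed_segment q x) ?g"
  proof (intro continuous_intros ballI)
    fix z assume "z \<in> closed_segment q x"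
    then have "z \<in> ball 0 1"
      using sub by (auto simp: hball_def)
    then show "1 - (norm z)\<^sup>2 \<noteq> 0"
      using norm_sq_less_1 by fastforce
  qed
  then have "connected (?g ` closed_segment q x)"
    by (intro connected_continuous_image) auto
  \<comment> \<open>An intermediate value theorem that does not ask which of \<open>?g q\<close> and
    \<open>?g x\<close> is larger, so that it serves both directions.\<close>
  then have "convex (?g ` closed_segment q x)"
    by (simp add: connected_convex_1)
  then have "closed_segment (?g q) (?g x) \<subseteq> ?g ` closed_segment q x"
    by (intro closed_segment_subset) auto
  then show ?thesis
    using assms(4) sub by force
qed

text \<open>Going outwards, the segment meets the inner boundary sphere of region \<open>a\<close>,
  where the factor is \<open>w powi (a - 1)\<close>.\<close>

lemma hball_meets_region_above:
  fixes q x :: "'a::euclidean_space"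
  assumes "w > 1" "q \<in> ball 0 1" "x \<in> ball 0 1"
    and "band_index w q < a" "a \<le> band_index w x"
  shows "region w a \<inter> hball q (hdist q x) \<noteq> {}"
proof -
  have "1 / (1 - (norm q)\<^sup>2) \<le> w powi (band_index w q)"
    using mem_region_band_index[OF assms(1,2)] by (simp add: region_def)
  also have "\<dots> \<le> w powi (a - 1)"
    using assms by (intro power_int_increasing) auto
  finally have 1: "1 / (1 - (norm q)\<^sup>2) \<le> w powi (a - 1)" .
  have "w powi (a - 1) \<le> w powi (band_index w x - 1)"
    using assms by (intro power_int_increasing) auto
  also have "\<dots> \<le> 1 / (1 - (norm x)\<^sup>2)"
    using mem_region_band_index[OF assms(1,3)] by (simp add: region_def)
  finally have "w powi (a - 1) \<in> closed_segment (1 / (1 - (norm q)\<^sup>2)) (1 / (1 - (norm x)\<^sup>2))"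
    using 1 by (auto simp: closed_segment_eq_real_ivl)
  then obtain z where z: "z \<in> hball q (hdist q x)" "1 / (1 - (norm z)\<^sup>2) = w powi (a - 1)"
    using segment_meets_sphere[OF assms(1-3)] by blast
  moreover have "w powi (a - 1) \<le> w powi a"
    using assms by (intro power_int_increasing) auto
  ultimately have "z \<in> region w a"
    unfolding region_def hball_def by auto
  then show ?thesis
    using z by blast
qed

text \<open>Going inwards, the segment meets the outer boundary sphere of region \<open>b\<close>,
  where the factor is \<open>w powi b\<close>.\<close>

lemma hball_meets_region_below:
  fixes q x :: "'a::euclidean_space"
  assumes "w > 1" "q \<in> ball 0 1" "x \<in> ball 0 1"
    and "b < band_index w q" "band_index w x \<le> b"
  shows "region w b \<inter> hball q (hdist q x) \<noteq> {}"
proof -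
  have "1 / (1 - (norm x)\<^sup>2) \<le> w powi (band_index w x)"
    using mem_region_band_index[OF assms(1,3)] by (simp add: region_def)
  also have "\<dots> \<le> w powi b"
    using assms by (intro power_int_increasing) auto
  finally have 1: "1 / (1 - (norm x)\<^sup>2) \<le> w powi b" .
  have "w powi b \<le> w powi (band_index w q - 1)"
    using assms by (intro power_int_increasing) auto
  also have "\<dots> \<le> 1 / (1 - (norm q)\<^sup>2)"
    using mem_region_band_index[OF assms(1,2)] by (simp add: region_def)
  finally have "w powi b \<in> closed_segment (1 / (1 - (norm q)\<^sup>2)) (1 / (1 - (norm x)\<^sup>2))"
    using 1 by (auto simp: closed_segment_eq_real_ivl)
  then obtain z where z: "z \<in> hball q (hdist q x)" "1 / (1 - (norm z)\<^sup>2) = w powi b"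
    using segment_meets_sphere[OF assms(1-3)] by blast
  moreover have "w powi (b - 1) \<le> w powi b"
    using assms by (intro power_int_increasing) auto
  ultimately have "z \<in> region w b"
    unfolding region_def hball_def by auto
  then show ?thesis
    using z by blast
qed

text \<open>The conformal factor is never below 1. This bounds the downward walk.\<close>

lemma region_nonempty_imp_nonneg:
  assumes "w > 1" "x \<in> region w b"
  shows "b \<ge> 0"
proof (rule ccontr)
  assume "\<not> b \<ge> 0"
  then have "w powi b < 1"
    using power_int_strict_increasing[of b 0 w] assms(1) by simp
  moreover have "1 \<le> 1 / (1 - (norm x)\<^sup>2)"
    using assms(2) norm_sq_less_1[of x] by (simp add: region_def)
  ultimately show False
    using assms(2) by (simp add: region_def)
qed

lemma hball_region_index_bounded:
  fixes q :: "'a::euclidean_space"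
  assumes "w > 1" "q \<in> ball 0 1" "r \<ge> 0"
  shows "\<exists>N. \<forall>a. region w a \<inter> hball q r \<noteq> {} \<longrightarrow> a \<le> N"
proof -
  obtain M where M: "\<forall>x \<in> hball q r. 1 / (1 - (norm x)\<^sup>2) \<le> M"
    using hball_conformal_factor_bounded[OF assms(2,3)] by blast
  obtain n where n: "M < w ^ n"
    using real_arch_pow[OF assms(1)] by blast
  have "a \<le> int n" if "x \<in> region w a" "x \<in> hball q r" for a x
  proof (rule ccontr)
    assume "\<not> a \<le> int n"
    \<comment> \<open>Since \<open>a - 1\<close> is still at least \<open>n\<close>, even the inner
      boundary of region \<open>a\<close> has a factor above \<open>M\<close>.\<close>
    then have "w powi (int n) \<le> w powi (a - 1)"
      using assms(1) by (intro power_int_increasing) auto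
    then show False
      using M n that by (force simp: region_def)
  qed
  then show ?thesis by blast
qed

section \<open>Loss of the Euclidean oracle within one band\<close>

lemma oracle_hyperbolic_approx:
  fixes orc :: "'a::euclidean_space \<Rightarrow> 'a set \<Rightarrow> 'a"
  assumes "\<epsilon> \<ge> 0" "approx_nn_oracle \<epsilon> orc" "w > 1" "finite D" "D \<subseteq> ball 0 1" "q \<in> ball 0 1"
    and x: "x \<in> band w D i"
  shows "hdist q (orc q (band w D i)) \<le> sqrt w * (1 + \<epsilon>) * hdist q x"
proof -
  define c where "c = sqrt w * (1 + \<epsilon>)"
  define p where "p = orc q (band w D i)"
  have c: "c \<ge> 1"
    using mult_mono[of 1 "sqrt w" 1 "1 + \<epsilon>"] assms(1,3) by (simp add: c_def)
  \<comment> \<open>\<open>(1 + \<epsilon>)\<^sup>2\<close> comes from the squared norms and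
    \<open>w\<close> from the ratio \<open>gp / gx\<close>; the bound is on a squared
    \<open>sinh\<close>, hence the root in \<open>c\<close>.\<close>
  have c2: "c\<^sup>2 = w * (1 + \<epsilon>)\<^sup>2"
    using assms(3) by (simp add: c_def power_mult_distrib)
  have fin: "finite (band w D i)"
    using assms(4) by (simp add: band_def)
  have ne: "band w D i \<noteq> {}"
    using x by blast
  obtain n where n: "is_arg_min (\<lambda>p. norm (q - p)) (\<lambda>p. p \<in> band w D i) n"
    using ex_is_arg_min_if_finite[OF fin ne] by blast
  have p: "p \<in> band w D i" "norm (p - q) \<le> (1 + \<epsilon>) * norm (q - n)"
    using assms(2) fin ne n unfolding approx_nn_oracle_def p_def by blast+
  have "norm (q - n) \<le> norm (q - x)"
    using n x by (auto simp: is_arg_min_linorder)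
  then have "(1 + \<epsilon>) * norm (q - n) \<le> (1 + \<epsilon>) * norm (q - x)"
    using assms(1) by (intro mult_left_mono) auto
  then have "norm (q - p) \<le> (1 + \<epsilon>) * norm (q - x)"
    using p(2) norm_minus_commute[of q p] by linarith
  then have e: "(norm (q - p))\<^sup>2 \<le> (1 + \<epsilon>)\<^sup>2 * (norm (q - x))\<^sup>2"
    using power_mono[of "norm (q - p)" _ 2] by (simp flip: power_mult_distrib)
  have pb: "p \<in> ball 0 1" "band_index w p = i" and xb: "x \<in> ball 0 1" "band_index w x = i"
    using p(1) x assms(5) by (auto simp: band_def)
  define gp where "gp = 1 / (1 - (norm p)\<^sup>2)"
  define gx where "gx = 1 / (1 - (norm x)\<^sup>2)"
  define gq where "gq = 1 / (1 - (norm q)\<^sup>2)"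
  have pos: "gp > 0" "gx > 0" "gq > 0"
    using norm_sq_less_1[OF pb(1)] norm_sq_less_1[OF xb(1)] norm_sq_less_1[OF assms(6)]
    by (auto simp: gp_def gx_def gq_def)
  \<comment> \<open>\<open>p\<close> and \<open>x\<close> share the index \<open>i\<close>: the
    upper region bound for \<open>p\<close> meets the lower one for \<open>x\<close>. The factor
    \<open>gq\<close> is common to both distances.\<close>
  have "gp \<le> w powi i"
    using mem_region_band_index[OF assms(3) pb(1)] pb(2) by (simp add: region_def gp_def)
  also have "\<dots> = w * w powi (i - 1)"
    using assms(3) by (simp add: power_int_diff)
  also have "\<dots> \<le> w * gx"
    using mem_region_band_index[OF assms(3) xb(1)] xb(2) assms(3)
    by (intro mult_left_mono) (auto simp: region_def gx_def)
  finally have g: "gp \<le> w * gx" .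
  have "(sinh (hdist q p / 2))\<^sup>2 = (norm (q - p))\<^sup>2 * gq * gp"
    by (simp add: sinh_half_hdist[OF assms(6) pb(1)] gq_def gp_def)
  also have "\<dots> \<le> ((1 + \<epsilon>)\<^sup>2 * (norm (q - x))\<^sup>2) * gq * (w * gx)"
    using e g pos by (intro mult_mono) auto
  also have "\<dots> = c\<^sup>2 * ((norm (q - x))\<^sup>2 * gq * gx)"
    by (simp add: c2)
  also have "\<dots> = (c * sinh (hdist q x / 2))\<^sup>2"
    by (simp add: sinh_half_hdist[OF assms(6) xb(1)] gq_def gx_def power_mult_distrib)
  finally have "sinh (hdist q p / 2) \<le> c * sinh (hdist q x / 2)"
    using c hdist_nonneg[OF assms(6) xb(1)] by (auto intro: power2_le_imp_le)
  also have "\<dots> \<le> sinh (c * (hdist q x / 2))"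
    using c hdist_nonneg[OF assms(6) xb(1)] by (intro mult_sinh_le_sinh_mult) auto
  finally have "hdist q p / 2 \<le> c * (hdist q x / 2)"
    by (simp only: sinh_real_le_iff)
  then have "hdist q p \<le> c * hdist q x"
    by simp
  then show ?thesis
    unfolding p_def c_def .
qed

section \<open>Loop invariant\<close>

definition approx_in :: "real \<Rightarrow> 'a::euclidean_space \<Rightarrow> 'a set \<Rightarrow> 'a option \<Rightarrow> bool" where
  "approx_in c q S nH \<longleftrightarrow>
     (case nH of None \<Rightarrow> S = {} | Some p \<Rightarrow> p \<in> S \<and> (\<forall>x\<in>S. hdist q p \<le> c * hdist q x))"

text \<open>The surviving candidate is no farther from \<open>q\<close> than either of the two, so
  it inherits both bounds.\<close>

lemma approx_in_update:
  assumes "approx_in c q S nH" "approx_in c q T nF"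
  shows "approx_in c q (S \<union> T) (update q nH nF)"
  using assms by (cases nH; cases nF) (force simp: approx_in_def)+

text \<open>Both bounds are strict because \<open>a\<close> and \<open>b\<close> are the next
  indices still to be probed.\<close>

definition probed :: "real \<Rightarrow> 'a::euclidean_space set \<Rightarrow> int \<Rightarrow> int \<Rightarrow> 'a set" where
  "probed w D a b = {x \<in> D. b < band_index w x \<and> band_index w x < a}"

fun nn_inv :: "real \<Rightarrow> real \<Rightarrow> 'a::euclidean_space set \<Rightarrow> 'a \<Rightarrow> 'a nn_state \<Rightarrow> bool" where
  "nn_inv c w D q (a, b, nH) \<longleftrightarrow>
     b < band_index w q \<and> band_index w q < a \<and> approx_in c q (probed w D a b) nH"

lemma nn_inv_step:
  assumes "\<And>i. approx_in c q (band w D i) (probe orc q (band w D i))"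
    and "nn_inv c w D q s"
  shows "nn_inv c w D q (nn_step orc sel w D q s)"
proof -
  obtain a b nH where s: "s = (a, b, nH)"
    by (metis prod_cases3)
  have inv: "b < band_index w q" "band_index w q < a" "approx_in c q (probed w D a b) nH"
    using assms(2) by (auto simp: s)
  \<comment> \<open>Since \<open>b < a\<close>, one probe extends the contiguous range by exactly
    one band.\<close>
  have up: "probed w D (a + 1) b = probed w D a b \<union> band w D a"
    and down: "probed w D a (b - 1) = probed w D a b \<union> band w D b"
    using inv(1,2) by (auto simp: probed_def band_def)
  show ?thesis
    using inv approx_in_update[OF inv(3) assms(1)]
    by (auto simp: s nn_step_def up down)
qed

section \<open>Termination\<close>

lemma eligible_bounds:
  fixes q :: "'a::euclidean_space"
  assumes "w > 1" "finite D" "D \<subseteq> ball 0 1" "q \<in> ball 0 1"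
  shows "\<exists>N. \<forall>a b nH. set_option nH \<subseteq> D \<longrightarrow>
    (above_eligible w D q (a, b, nH) \<longrightarrow> a \<le> N) \<and> (below_eligible w D q (a, b, nH) \<longrightarrow> 0 \<le> b)"
proof -
  \<comment> \<open>Every candidate is a data point, so all candidate balls lie in
    \<open>hball q r\<close> and one \<open>N\<close> serves the whole run. The inserted 0 covers an
    empty \<open>D\<close>.\<close>
  define r where "r = Max (insert 0 (hdist q ` D))"
  have r: "r \<ge> 0" and le_r: "\<And>x. x \<in> D \<Longrightarrow> hdist q x \<le> r"
    using assms(2) by (auto simp: r_def)
  obtain N where N: "\<And>a. region w a \<inter> hball q r \<noteq> {} \<Longrightarrow> a \<le> N"
    using hball_region_index_bounded[OF assms(1,4) r] by blast
  \<comment> \<open>Data points obey the same index bounds, which settles states without a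
    candidate.\<close>
  have reg: "x \<in> region w (band_index w x) \<inter> hball q r" if "x \<in> D" for x
    using mem_region_band_index[OF assms(1), of x] that assms(3) le_r by (auto simp: hball_def)
  have idx: "0 \<le> band_index w x \<and> band_index w x \<le> N" if "x \<in> D" for x
    using reg[OF that] N region_nonempty_imp_nonneg[OF assms(1)] by blast
  have "a \<le> N" if "set_option nH \<subseteq> D" "above_eligible w D q (a, b, nH)" for a b nH
  proof (cases nH)
    case None
    then show ?thesis
      using that idx by force
  next
    case (Some p)
    then have "region w a \<inter> hball q r \<noteq> {}"
      using that le_r[of p] by (fastforce simp: hball_def)
    then show ?thesis
      by (rule N)
  qed
  moreover have "0 \<le> b" if "set_option nH \<subseteq> D" "below_eligible w D q (a, b, nH)" for a b nH
  proof (cases nH)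
    case None
    then show ?thesis
      using that idx by force
  next
    case (Some p)
    then show ?thesis
      using that region_nonempty_imp_nonneg[OF assms(1)] by auto
  qed
  ultimately show ?thesis by blast
qed

lemma nn_loop_terminates:
  fixes q :: "'a::euclidean_space"
  assumes "w > 1" "finite D" "D \<subseteq> ball 0 1" "q \<in> ball 0 1"
    and "\<And>i. approx_in c q (band w D i) (probe orc q (band w D i))"
    and "nn_inv c w D q s"
  shows "\<exists>t. while_option (\<lambda>s. above_eligible w D q s \<or> below_eligible w D q s)
    (nn_step orc sel w D q) s = Some t"
proof -
  obtain N where N: "\<And>a b nH. set_option nH \<subseteq> D \<Longrightarrow>
    (above_eligible w D q (a, b, nH) \<longrightarrow> a \<le> N) \<and> (below_eligible w D q (a, b, nH) \<longrightarrow> 0 \<le> b)"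
    using eligible_bounds[OF assms(1-4)] by blast
  \<comment> \<open>Counts the indices left in \<open>a..N\<close> and in
    \<open>0..b\<close>.\<close>
  define f :: "'a nn_state \<Rightarrow> nat" where "f = (\<lambda>(a, b, nH). nat (N + 1 - a) + nat (b + 1))"
  show ?thesis
  proof (rule measure_while_option_Some[where P = "nn_inv c w D q" and f = f])
    fix s assume inv: "nn_inv c w D q s"
      and el: "above_eligible w D q s \<or> below_eligible w D q s"
    obtain a b nH where s: "s = (a, b, nH)"
      by (metis prod_cases3)
    have "set_option nH \<subseteq> D"
      using inv by (auto simp: s approx_in_def probed_def)
    \<comment> \<open>Whatever \<open>sel\<close> says, the step moves in an eligible direction: if
      \<open>choose_above\<close> fails, the guard leaves \<open>below_eligible\<close>. So the
      summand that shrinks was positive.\<close>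
    from N[OF this, of a b] have "f (nn_step orc sel w D q s) < f s"
      using el by (auto simp: s f_def nn_step_def choose_above_def)
    then show "nn_inv c w D q (nn_step orc sel w D q s) \<and> f (nn_step orc sel w D q s) < f s"
      using nn_inv_step[OF assms(5) inv] by simp
  qed fact
qed

section \<open>Correctness at exit\<close>

lemma stopped_candidate_approx:
  fixes q :: "'a::euclidean_space"
  assumes "w > 1" "D \<subseteq> ball 0 1" "q \<in> ball 0 1" "c \<ge> 1"
    and inv: "nn_inv c w D q (a, b, nH)"
    and stop: "\<not> above_eligible w D q (a, b, nH)" "\<not> below_eligible w D q (a, b, nH)"
    and x: "x \<in> D"
  shows "\<exists>p. nH = Some p \<and> p \<in> D \<and> hdist q p \<le> c * hdist q x"
proof (cases nH)
  case None
  \<comment> \<open>No data is left in either direction, so \<open>x\<close> was probed; but without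
    a candidate the probed set is empty.\<close>
  then have "\<not> a \<le> band_index w x" "\<not> band_index w x \<le> b"
    using stop x by auto
  then have "x \<in> probed w D a b"
    using x by (auto simp: probed_def)
  then show ?thesis
    using inv None by (simp add: approx_in_def)
next
  case (Some p)
  have xb: "x \<in> ball 0 1"
    using x assms(2) by auto
  have "hdist q p \<le> c * hdist q x"
  proof (cases "x \<in> probed w D a b")
    case True
    then show ?thesis
      using inv Some by (simp add: approx_in_def)
  next
    case False
    then have "a \<le> band_index w x \<or> band_index w x \<le> b"
      using x by (auto simp: probed_def)
    then have "region w a \<inter> hball q (hdist q x) \<noteq> {} \<or> region w b \<inter> hball q (hdist q x) \<noteq> {}"
      using hball_meets_region_above[OF assms(1,3) xb] hball_meets_region_below[OF assms(1,3) xb] inv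
      by auto
    \<comment> \<open>Otherwise the ball through \<open>x\<close> would lie in the candidate's ball,
      and a region next in line would still be eligible.\<close>
    then have "\<not> hdist q x \<le> hdist q p"
      using stop Some by (fastforce simp: hball_def)
    moreover have "1 * hdist q x \<le> c * hdist q x"
      using assms(4) hdist_nonneg[OF assms(3) xb] by (intro mult_right_mono)
    ultimately show ?thesis by simp
  qed
  moreover have "p \<in> D"
    using inv Some by (simp add: approx_in_def probed_def)
  ultimately show ?thesis
    using Some by simp
qed

theorem theorem3:
  fixes orc :: "real ^ 'r \<Rightarrow> (real ^ 'r) set \<Rightarrow> real ^ 'r"
    and sel :: "(real ^ 'r) nn_state \<Rightarrow> bool"
    and \<epsilon> w :: real
    and D :: "(real ^ 'r) set"
    and q nstar :: "real ^ 'r"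
  assumes "\<epsilon> \<ge> 0"
    and "approx_nn_oracle \<epsilon> orc"
    and "w > 1"
    and "finite D"
    and "D \<subseteq> ball 0 1"
    and "q \<in> ball 0 1"
    and "is_arg_min (hdist q) (\<lambda>x. x \<in> D) nstar"
  shows "\<exists>nH. spherical_shell_nn orc sel w D q = Some nH \<and> nH \<in> D \<and>
           hdist q nH \<le> sqrt w * (1 + \<epsilon>) * hdist q nstar"
proof -
  define c where "c = sqrt w * (1 + \<epsilon>)"
  have c: "c \<ge> 1"
    using mult_mono[of 1 "sqrt w" 1 "1 + \<epsilon>"] assms(1,3) by (simp add: c_def)
  have nstar: "nstar \<in> D"
    using assms(7) by (simp add: is_arg_min_def)
  have probe: "approx_in c q (band w D i) (probe orc q (band w D i))" for i
  proof (cases "band w D i = {}")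
    case False
    have "finite (band w D i)"
      using assms(4) by (simp add: band_def)
    then have "orc q (band w D i) \<in> band w D i"
      using assms(2) False unfolding approx_nn_oracle_def by blast
    then show ?thesis
      using False oracle_hyperbolic_approx[OF assms(1-6)]
      by (auto simp: approx_in_def probe_def c_def)
  qed (simp add: approx_in_def probe_def)
  let ?i = "band_index w q"
  let ?s = "(?i + 1, ?i - 1, probe orc q (band w D ?i))"
  \<comment> \<open>Only \<open>?i\<close> lies strictly between \<open>?i - 1\<close> and
    \<open>?i + 1\<close>, so the initial probe establishes the invariant.\<close>
  have "probed w D (?i + 1) (?i - 1) = band w D ?i"
    by (auto simp: probed_def band_def)
  then have inv: "nn_inv c w D q ?s"
    using probe by simp
  obtain a b nH where t: "while_option (\<lambda>s. above_eligible w D q s \<or> below_eligible w D q s)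
      (nn_step orc sel w D q) ?s = Some (a, b, nH)"
    using nn_loop_terminates[OF assms(3-6) probe inv] by (metis prod_cases3)
  have "nn_inv c w D q (a, b, nH)"
    using while_option_rule[where P = "nn_inv c w D q", OF _ t inv] nn_inv_step[OF probe] by blast
  then obtain p where "nH = Some p" "p \<in> D" "hdist q p \<le> c * hdist q nstar"
    using stopped_candidate_approx[OF assms(3,5,6) c _ _ _ nstar] while_option_stop[OF t] by blast
  then show ?thesis
    using t by (simp add: spherical_shell_nn_def c_def)
qed

end
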